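(* Let $0<s<m$ and let $\boldsymbol F[\boldsymbol u]_{t,\boldsymbol x}=\boldsymbol 0$ ($t\in\mathcal I$, $\boldsymbol x\in\Omega$) be a system of $m$ PDEs of order $d$ for $\boldsymbol u=(u^1,\dots,u^m)$ with $s$ conservation laws, i.e. with an $s\times m$ matrix $\Lambda$ of conservation law multipliers (of order $r$), densities $\boldsymbol\psi=(\psi^1,\dots,\psi^s)^T$ and fluxes $\Phi=(\phi^{ji})_{1\le j\le s,\,1\le i\le n}$. Partition $$\Lambda=\begin{pmatrix}\widetilde\Lambda&\Sigma\end{pmatrix},\qquad \boldsymbol F=\begin{pmatrix}\widetilde{\boldsymbol F}\\ \boldsymbol G\end{pmatrix},$$ with $\widetilde\Lambda$ of size $s\times s$, $\Sigma$ of size $s\times(m-s)$, $\widetilde{\boldsymbol F}$ the first $s$ and $\boldsymbol G$ the last $m-s$ entries of $\boldsymbol F$. Let $\boldsymbol u\in C^{\max(p,q)+\max(r,d)}(\overline{\mathcal I\times\Omega})$. Suppose $\widetilde\Lambda^{\tau,h}$, $D_t^{\tau,h}\boldsymbol\psi$, $D_{\boldsymbol x}^{\tau,h}\cdot\Phi$, $\Sigma^{\tau,h}$ and $\boldsymbol G^{\tau,h}$ are finite difference discretizations of $\widetilde\Lambda$, $D_t\boldsymbol\psi$, $D_{\boldsymbol x}\cdot\Phi$, $\Sigma$ and $\boldsymbol G$ with accuracy up to order $p$ in space and $q$ in time, i.e., with all outer norms taken in $l^\infty(\mathcal I^\tau\times\Omega^h)$, $$\big\|\,\|\widetilde\Lambda[\boldsymbol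 u]-\widetilde\Lambda^{\tau,h}\{\boldsymbol u\}\|_{op}\big\|\le C_{\widetilde\Lambda}(h^p+\tau^q),\quad \|D_t\boldsymbol\psi[\boldsymbol u]-D_t^{\tau,h}\boldsymbol\psi\{\boldsymbol u\}\|\le C_t(h^p+\tau^q),$$ $$\|D_{\boldsymbol x}\cdot\Phi[\boldsymbol u]-D_{\boldsymbol x}^{\tau,h}\cdot\Phi\{\boldsymbol u\}\|\le C_x(h^p+\tau^q),\quad \big\|\,\|\Sigma[\boldsymbol u]-\Sigma^{\tau,h}\{\boldsymbol u\}\|_{op}\big\|\le C_\Sigma(h^p+\tau^q),$$ $$\|\boldsymbol G[\boldsymbol u]-\boldsymbol G^{\tau,h}\{\boldsymbol u\}\|\le C_G(h^p+\tau^q).$$ Let $\boldsymbol u^{\tau,h}:\mathcal I^\tau\times\Omega^h\to\mathbb R^m$ be a discrete function. Suppose $\widetilde\Lambda^{\tau,h}\{\boldsymbol u^{\tau,h}\}$ is invertible on $\mathcal I^\tau\times\Omega^h$ and that $\big\|\,\|(\widetilde\Lambda^{\tau,h})^{-1}\{\boldsymbol u^{\tau,h}\}\|_{op}\big\|_{l^\infty(\mathcal I^\tau\times\Omega^h)}\le\gamma<\infty$, with $\gamma$ independent of $\tau,h$. Define the finite difference discretization of $\boldsymbol F$ as $$\boldsymbol F^{\tau,h}\{\boldsymbol u^{\tau,h}\}:=\begin{pmatrix}\widetilde{\boldsymbol F}^{\tau,h}\{\boldsymbol u^{\tau,h}\}\\ \boldsymbol G^{\tau,h}\{\boldsymbol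 u^{\tau,h}\}\end{pmatrix}=\begin{pmatrix}(\widetilde\Lambda^{\tau,h})^{-1}\{\boldsymbol u^{\tau,h}\}\left(D_t^{\tau,h}\boldsymbol\psi\{\boldsymbol u^{\tau,h}\}+D_{\boldsymbol x}^{\tau,h}\cdot\Phi\{\boldsymbol u^{\tau,h}\}-\Sigma^{\tau,h}\{\boldsymbol u^{\tau,h}\}\boldsymbol G^{\tau,h}\{\boldsymbol u^{\tau,h}\}\right)\\ \boldsymbol G^{\tau,h}\{\boldsymbol u^{\tau,h}\}\end{pmatrix}.$$ Then there exists a constant $\widetilde C>0$ independent of $h,\tau$ such that for sufficiently small $h,\tau$, $$\|\widetilde{\boldsymbol F}[\boldsymbol u]-\widetilde{\boldsymbol F}^{\tau,h}\{\boldsymbol u\}\|_{l^\infty(\mathcal I^\tau\times\Omega^h)}\le\widetilde C(h^p+\tau^q),$$ and hence there exists a constant $C>0$ independent of $h,\tau$ such that for sufficiently small $h,\tau$, $$\|\boldsymbol F[\boldsymbol u]-\boldsymbol F^{\tau,h}\{\boldsymbol u\}\|_{l^\infty(\mathcal I^\tau\times\Omega^h)}\le C(h^p+\tau^q).$$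
   Context: $\mathcal I=(0,T)$; $\Omega\subset\mathbb R^n$ is a bounded domain. $\boldsymbol F[\boldsymbol u]_{t,\boldsymbol x}\in\mathbb R^m$ denotes the value at $(t,\boldsymbol x)$ of a function (continuous in its arguments) of $t,\boldsymbol x,\boldsymbol u$ and the partial derivatives of $\boldsymbol u$ up to order $d$; similarly for other differential functions. $D_t$, $D_{x_i}$ are total derivatives and $(D_{\boldsymbol x}\cdot\Phi)^j=\sum_{i=1}^nD_{x_i}\phi^{ji}$. $\Lambda$ (analytic entries depending on derivatives of $\boldsymbol u$ up to order $r$) is a matrix of conservation law multipliers with (analytic) densities $\boldsymbol\psi$ and fluxes $\Phi$, depending on derivatives of order at most $\max(r,d)-1$, if $\Lambda[\boldsymbol u]\boldsymbol F[\boldsymbol u]=D_t\boldsymbol\psi[\boldsymbol u]+D_{\boldsymbol x}\cdot\Phi[\boldsymbol u]$ holds identically (not only on solutions). Mesh: $\mathcal I^\tau=\{k\tau:k=0,\dots,\lfloor T/\tau\rfloor\}$ with time step $\tau$, and $\Omega^h=\Omega\cap h\mathbb Z^n$ with mesh size $h$, with points $t_k$, $\boldsymbol x_J$. A finite difference discretization $A^{\tau,h}$ is an expression whose value at $(t_k,\boldsymbol x_J)$ depends on $t_k,\boldsymbol x_J$ and mesh values of its argument: $A^{\tau,h}\{\boldsymbol u^{\tau,h}\}$ is evaluated on the values of a discrete function $\boldsymbol u^{\tau,h}$, and $A^{\tau,h}\{\boldsymbol u\}$, for a continuous function $\boldsymbol u$ on $\overline{\mathcal I\times\Omega}$, is the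 same expression evaluated on the mesh values $\boldsymbol u(t_k,\boldsymbol x_J)$. $\|\cdot\|_{l^\infty(\mathcal I^\tau\times\Omega^h)}$ is the maximum over mesh points of the vector norm $|\cdot|$ (or of a scalar), and $\|\cdot\|_{op}$ is the matrix norm induced by $|\cdot|$. The constants $C_{\widetilde\Lambda},C_t,C_x,C_\Sigma,C_G$ do not depend on $\tau,h$. *)

theory Defs
  imports "HOL-Analysis.Analysis"
begin

text \<open>
  Space-time is \<open>real \<times> (real ^ 'n)\<close>. The independent variables are indexed by \<open>'n option\<close>:
  \<open>None\<close> is time and \<open>Some i\<close> is the space variable with index \<open>i\<close>. A multi-index is a function
  \<open>'n option \<Rightarrow> nat\<close>. The sum type \<open>'s + 'g\<close> indexes the \<open>m\<close> equations and unknowns, so that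
  \<open>s = CARD('s)\<close> and \<open>m - s = CARD('g)\<close>, both positive.
\<close>

definition dir :: "'n option \<Rightarrow> real \<times> (real ^ 'n::finite)" where
  "dir c = (case c of None \<Rightarrow> (1, 0) | Some i \<Rightarrow> (0, axis i 1))"

definition bump :: "'n option \<Rightarrow> ('n option \<Rightarrow> nat) \<Rightarrow> ('n option \<Rightarrow> nat)" where
  "bump c \<alpha> = \<alpha>(c := Suc (\<alpha> c))"

definition msize :: "('n::finite option \<Rightarrow> nat) \<Rightarrow> nat" where
  "msize \<alpha> = (\<Sum>c\<in>UNIV. \<alpha> c)"

text \<open>
  \<open>has_partials k Q u w\<close>: for \<open>msize \<alpha> \<le> k\<close>, \<open>w \<alpha>\<close> is the partial derivative of \<open>u\<close> with multi-index
  \<open>\<alpha>\<close> on the open set \<open>Q\<close>, extended continuously to \<open>closure Q\<close>; on \<open>closure Q\<close> it is determined by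
  \<open>u\<close>.
\<close>

definition has_partials ::
  "nat \<Rightarrow> (real \<times> (real ^ 'n::finite)) set \<Rightarrow> (real \<times> (real ^ 'n) \<Rightarrow> real ^ 'm::finite)
    \<Rightarrow> (('n option \<Rightarrow> nat) \<Rightarrow> real \<times> (real ^ 'n) \<Rightarrow> real ^ 'm) \<Rightarrow> bool" where
  "has_partials k Q u w \<longleftrightarrow>
     (\<forall>z\<in>closure Q. w (\<lambda>_. 0) z = u z) \<and>
     (\<forall>\<alpha>. msize \<alpha> \<le> k \<longrightarrow> continuous_on (closure Q) (w \<alpha>)) \<and>
     (\<forall>\<alpha> c. msize \<alpha> < k \<longrightarrow> (\<forall>z\<in>Q.
        ((\<lambda>y. w \<alpha> (z + y *\<^sub>R dir c)) has_vector_derivative w (bump c \<alpha>) z) (at 0)))"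

definition C_closure ::
  "nat \<Rightarrow> (real \<times> (real ^ 'n::finite)) set \<Rightarrow> (real \<times> (real ^ 'n) \<Rightarrow> real ^ 'm::finite) set" where
  "C_closure k Q = {u. \<exists>w. has_partials k Q u w}"

definition partial ::
  "(real \<times> (real ^ 'n::finite)) set \<Rightarrow> (real \<times> (real ^ 'n) \<Rightarrow> real ^ 'm::finite)
    \<Rightarrow> ('n option \<Rightarrow> nat) \<Rightarrow> real \<times> (real ^ 'n) \<Rightarrow> real ^ 'm" where
  "partial Q u \<alpha> = (SOME w. has_partials (msize \<alpha>) Q u w) \<alpha>"

text \<open>
  Coordinates of the jet space: the independent variables, and one coordinate \<open>Dep j \<alpha>\<close> for each
  derivative of the \<open>j\<close>-th unknown. A jet assigns a real number to every coordinate, and a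
  differential function is a function of a jet that only depends on finitely many orders.
\<close>

datatype ('m, 'n) jvar = Indep "'n option" | Dep 'm "'n option \<Rightarrow> nat"

type_synonym ('m, 'n) jet = "('m, 'n) jvar \<Rightarrow> real"

definition base :: "('m, 'n::finite) jet \<Rightarrow> real \<times> (real ^ 'n)" where
  "base z = (z (Indep None), \<chi> i. z (Indep (Some i)))"

definition jet_of ::
  "(real \<times> (real ^ 'n::finite)) set \<Rightarrow> (real \<times> (real ^ 'n) \<Rightarrow> real ^ 'm::finite)
    \<Rightarrow> real \<times> (real ^ 'n) \<Rightarrow> ('m, 'n) jet" where
  "jet_of Q u tx v = (case v of
      Indep None \<Rightarrow> fst tx
    | Indep (Some i) \<Rightarrow> snd tx $ i
    | Dep j \<alpha> \<Rightarrow> partial Q u \<alpha> tx $ j)"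

definition jvars :: "nat \<Rightarrow> ('m, 'n::finite) jvar set" where
  "jvars k = range Indep \<union> {Dep j \<alpha> |j \<alpha>. msize \<alpha> \<le> k}"

definition order_le :: "('m, 'n::finite) jet set \<Rightarrow> nat \<Rightarrow> (('m, 'n) jet \<Rightarrow> 'b) \<Rightarrow> bool" where
  "order_le D k f \<longleftrightarrow> (\<forall>z\<in>D. \<forall>z'\<in>D. (\<forall>v\<in>jvars k. z v = z' v) \<longrightarrow> f z = f z')"

text \<open>
  \<open>analytic_order D k f\<close>: near every point of \<open>D\<close>, \<open>f\<close> is the sum of an (unconditionally) convergent
  power series in the finitely many coordinates \<open>jvars k\<close>.
\<close>

definition analytic_order ::
  "('m, 'n::finite) jet set \<Rightarrow> nat \<Rightarrow> (('m, 'n) jet \<Rightarrow> real) \<Rightarrow> bool" where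
  "analytic_order D k f \<longleftrightarrow> order_le D k f \<and>
     (\<forall>z0\<in>D. \<exists>\<rho>>0. \<exists>a :: (('m, 'n) jvar \<Rightarrow> nat) \<Rightarrow> real.
        \<forall>z. (\<forall>v\<in>jvars k. \<bar>z v - z0 v\<bar> < \<rho>) \<longrightarrow>
          ((\<lambda>\<beta>. a \<beta> * (\<Prod>v\<in>jvars k. (z v - z0 v) ^ \<beta> v)) has_sum f z)
            {\<beta>. \<forall>v. v \<notin> jvars k \<longrightarrow> \<beta> v = 0})"

definition jderiv :: "('m, 'n) jvar \<Rightarrow> (('m, 'n) jet \<Rightarrow> real) \<Rightarrow> ('m, 'n) jet \<Rightarrow> real" where
  "jderiv v f z = deriv (\<lambda>y. f (z(v := y))) (z v)"

text \<open>Total derivative of a differential function of order at most \<open>k\<close>.\<close>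

definition total_deriv ::
  "nat \<Rightarrow> 'n option \<Rightarrow> (('m::finite, 'n::finite) jet \<Rightarrow> real) \<Rightarrow> ('m, 'n) jet \<Rightarrow> real" where
  "total_deriv k c f z = jderiv (Indep c) f z +
     (\<Sum>j\<in>UNIV. \<Sum>\<alpha> | msize \<alpha> \<le> k. z (Dep j (bump c \<alpha>)) * jderiv (Dep j \<alpha>) f z)"

definition Dt :: "nat \<Rightarrow> (('m::finite, 'n::finite) jet \<Rightarrow> real ^ 's::finite) \<Rightarrow> ('m, 'n) jet \<Rightarrow> real ^ 's" where
  "Dt k \<psi> z = (\<chi> j. total_deriv k None (\<lambda>z. \<psi> z $ j) z)"

definition Dx :: "nat \<Rightarrow> (('m::finite, 'n::finite) jet \<Rightarrow> real ^ 'n ^ 's::finite) \<Rightarrow> ('m, 'n) jet \<Rightarrow> real ^ 's" where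
  "Dx k \<Phi> z = (\<chi> j. \<Sum>i\<in>UNIV. total_deriv k (Some i) (\<lambda>z. \<Phi> z $ j $ i) z)"

text \<open>
  \<open>D\<close> is the part of the jet space lying over the closed space-time domain; the identity is required
  at every jet, i.e. off solutions as well.
\<close>

definition conservation_law_multipliers ::
  "('m::finite, 'n::finite) jet set \<Rightarrow> nat \<Rightarrow> nat \<Rightarrow> (('m, 'n) jet \<Rightarrow> real ^ 'm)
    \<Rightarrow> (('m, 'n) jet \<Rightarrow> real ^ 'm ^ 's::finite) \<Rightarrow> (('m, 'n) jet \<Rightarrow> real ^ 's)
    \<Rightarrow> (('m, 'n) jet \<Rightarrow> real ^ 'n ^ 's) \<Rightarrow> bool" where
  "conservation_law_multipliers D r d F \<Lambda> \<psi> \<Phi> \<longleftrightarrow>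
     (\<forall>j k. analytic_order D r (\<lambda>z. \<Lambda> z $ j $ k)) \<and>
     (\<forall>j. analytic_order D (max r d - 1) (\<lambda>z. \<psi> z $ j)) \<and>
     (\<forall>j i. analytic_order D (max r d - 1) (\<lambda>z. \<Phi> z $ j $ i)) \<and>
     (\<forall>z\<in>D. \<Lambda> z *v F z = Dt (max r d - 1) \<psi> z + Dx (max r d - 1) \<Phi> z)"

definition left_block :: "real ^ ('s + 'g::finite) ^ 's \<Rightarrow> real ^ 's ^ 's::finite" where
  "left_block A = (\<chi> j k. A $ j $ Inl k)"

definition right_block :: "real ^ ('s + 'g::finite) ^ 's \<Rightarrow> real ^ 'g ^ 's::finite" where
  "right_block A = (\<chi> j k. A $ j $ Inr k)"

definition upper :: "real ^ ('s + 'g::finite) \<Rightarrow> real ^ 's::finite" where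
  "upper y = (\<chi> k. y $ Inl k)"

definition lower :: "real ^ ('s::finite + 'g) \<Rightarrow> real ^ 'g::finite" where
  "lower y = (\<chi> k. y $ Inr k)"

definition stack :: "real ^ 's \<Rightarrow> real ^ 'g \<Rightarrow> real ^ ('s::finite + 'g::finite)" where
  "stack a b = (\<chi> k. case k of Inl i \<Rightarrow> a $ i | Inr i \<Rightarrow> b $ i)"

definition time_mesh :: "real \<Rightarrow> real \<Rightarrow> real set" where
  "time_mesh T \<tau> = {real k * \<tau> |k. int k \<le> \<lfloor>T / \<tau>\<rfloor>}"

definition space_mesh :: "(real ^ 'n) set \<Rightarrow> real \<Rightarrow> (real ^ 'n::finite) set" where
  "space_mesh \<Omega> h = {x \<in> \<Omega>. \<forall>i. \<exists>j::int. x $ i = h * of_int j}"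

definition mesh :: "real \<Rightarrow> (real ^ 'n) set \<Rightarrow> real \<Rightarrow> real \<Rightarrow> (real \<times> (real ^ 'n::finite)) set" where
  "mesh T \<Omega> \<tau> h = time_mesh T \<tau> \<times> space_mesh \<Omega> h"

text \<open>Maximum over the mesh points, which are finitely many for bounded \<open>\<Omega>\<close>. Inserting \<open>0\<close> only matters when the mesh is empty (coarse \<open>h\<close>).\<close>

definition linf ::
  "real \<Rightarrow> (real ^ 'n::finite) set \<Rightarrow> real \<Rightarrow> real \<Rightarrow> (real \<times> (real ^ 'n) \<Rightarrow> 'b::real_normed_vector) \<Rightarrow> real" where
  "linf T \<Omega> \<tau> h f = Max (insert 0 ((\<lambda>z. norm (f z)) ` mesh T \<Omega> \<tau> h))"

definition op_norm :: "real ^ 'b ^ 'a \<Rightarrow> real" where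
  "op_norm A = onorm (\<lambda>v::real ^ 'b::finite. A *v v :: real ^ 'a::finite)"

text \<open>
  Discrete functions are represented by functions on all of space-time of which only the mesh values
  matter: a discretization \<open>A \<tau> h v\<close> may only depend on the values of \<open>v\<close> on the mesh. For
  a continuous \<open>u\<close>, \<open>A \<tau> h u\<close> is then the discretization evaluated on the mesh values of \<open>u\<close>.
\<close>

type_synonym ('m, 'n, 'b) fd_op =
  "real \<Rightarrow> real \<Rightarrow> (real \<times> (real ^ 'n) \<Rightarrow> real ^ 'm) \<Rightarrow> real \<times> (real ^ 'n) \<Rightarrow> 'b"

definition fd_discretization ::
  "real \<Rightarrow> (real ^ 'n::finite) set \<Rightarrow> ('m::finite, 'n, 'b) fd_op \<Rightarrow> bool" where
  "fd_discretization T \<Omega> A \<longleftrightarrow> (\<forall>\<tau>>0. \<forall>h>0. \<forall>v w.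
     (\<forall>z\<in>mesh T \<Omega> \<tau> h. v z = w z) \<longrightarrow> (\<forall>z\<in>mesh T \<Omega> \<tau> h. A \<tau> h v z = A \<tau> h w z))"

definition Ftilde_disc ::
  "('m, 'n, real ^ 's ^ 's) fd_op \<Rightarrow> ('m, 'n, real ^ 's) fd_op \<Rightarrow> ('m, 'n, real ^ 's) fd_op
    \<Rightarrow> ('m, 'n, real ^ 'g ^ 's) fd_op \<Rightarrow> ('m, 'n, real ^ 'g) fd_op
    \<Rightarrow> ('m::finite, 'n::finite, real ^ 's::finite) fd_op" where
  "Ftilde_disc Lh Dth Dxh Sh Gh \<tau> h v z =
     matrix_inv (Lh \<tau> h v z) *v (Dth \<tau> h v z + Dxh \<tau> h v z - Sh \<tau> h v z *v (Gh \<tau> h v z :: real ^ 'g::finite))"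

definition F_disc ::
  "('m, 'n, real ^ 's ^ 's) fd_op \<Rightarrow> ('m, 'n, real ^ 's) fd_op \<Rightarrow> ('m, 'n, real ^ 's) fd_op
    \<Rightarrow> ('m, 'n, real ^ 'g ^ 's) fd_op \<Rightarrow> ('m, 'n, real ^ 'g) fd_op
    \<Rightarrow> ('m::finite, 'n::finite, real ^ ('s::finite + 'g::finite)) fd_op" where
  "F_disc Lh Dth Dxh Sh Gh \<tau> h v z =
     stack (Ftilde_disc Lh Dth Dxh Sh Gh \<tau> h v z) (Gh \<tau> h v z)"

end

theory Submission
  imports Defs
begin

text \<open>
  The discretization \<open>(\<Lambda>\<^sub>h)\<inverse> (D\<^sub>t\<psi> + D\<^sub>x\<Phi> - \<Sigma>\<^sub>h G\<^sub>h)\<close> of the upper equations imitates what the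
  conservation law identity says about them: written in blocks, the identity is
  \<open>\<Lambda>' F' + \<Sigma> G = D\<^sub>t\<psi> + D\<^sub>x\<Phi>\<close>, where \<open>F'\<close>, \<open>G\<close> are the upper and lower equations and \<open>\<Lambda>'\<close>, \<open>\<Sigma>\<close> the
  corresponding column blocks of \<open>\<Lambda>\<close>. Multiplying the error by the discrete left block and
  eliminating \<open>\<Lambda>' F'\<close> with the identity expresses it through consistency errors only
  (\<open>block_error_identity\<close>):
  \<open>\<Lambda>\<^sub>h (F' - F'\<^sub>h) = (\<Lambda>\<^sub>h - \<Lambda>') F' + (D\<^sub>t\<psi> - D\<^sub>t\<psi>\<^sub>h) + (D\<^sub>x\<Phi> - D\<^sub>x\<Phi>\<^sub>h) - (\<Sigma> - \<Sigma>\<^sub>h) G - \<Sigma> (G - G\<^sub>h)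
    + (\<Sigma> - \<Sigma>\<^sub>h) (G - G\<^sub>h)\<close>.
  Stability, i.e. the bound \<open>\<gamma>\<close> on the inverse of the discrete left block, turns this into an error
  bound as soon as \<open>F'\<close>, \<open>G\<close> and \<open>\<Sigma>\<close> are bounded along the jets of \<open>u\<close>, uniformly in the mesh.

  The uniform bounds are compactness statements on the closed space-time domain, over which the jet
  coordinates of \<open>u\<close> up to the relevant order are continuous. A jet has infinitely many coordinates, and
  those of order beyond the smoothness of \<open>u\<close> are arbitrary numbers, so \<open>jet_of Q u\<close> need not
  be continuous as a map into the jet space. For \<open>F\<close> the cure is to set the coordinates
  of high order to zero, which leaves the value of \<open>F\<close> unchanged (\<open>bounded_along_jets\<close>). For
  the entries of \<open>\<Lambda>\<close>, which are given locally by power series, one compares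
  with the absolutely convergent series at a corner of a cube
  (\<open>analytic_order_bounded_along_jets\<close>).
\<close>

section \<open>Mesh maxima, operator norms and block vectors\<close>

lemma finite_time_mesh:
  assumes "0 < \<tau>"
  shows "finite (time_mesh T \<tau>)"
proof -
  have "time_mesh T \<tau> \<subseteq> (\<lambda>k. real k * \<tau>) ` {..nat \<lfloor>T / \<tau>\<rfloor>}"
    unfolding time_mesh_def by (auto intro!: imageI simp: le_nat_iff)
  then show ?thesis by (rule finite_subset) simp
qed

lemma finite_space_mesh:
  fixes \<Omega> :: "(real ^ 'n::finite) set"
  assumes "bounded \<Omega>" "0 < h"
  shows "finite (space_mesh \<Omega> h)"
proof -
  obtain B where B: "\<And>x. x \<in> \<Omega> \<Longrightarrow> norm x \<le> B"
    using assms(1) bounded_iff by blast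
  define J where "J = {-\<lceil>B / h\<rceil>..\<lceil>B / h\<rceil>}"
  have "space_mesh \<Omega> h \<subseteq> (\<lambda>j. \<chi> i. h * of_int (j i)) ` (UNIV \<rightarrow>\<^sub>E J)"
  proof
    fix x assume x: "x \<in> space_mesh \<Omega> h"
    then obtain j :: "'n \<Rightarrow> int" where j: "\<And>i. x $ i = h * of_int (j i)"
      unfolding space_mesh_def by (auto simp: choice_iff)
    have "j i \<in> J" for i
    proof -
      have "\<bar>h * of_int (j i)\<bar> \<le> B"
        using component_le_norm_cart[of x i] B[of x] x j[of i] by (auto simp: space_mesh_def)
      then have "of_int \<bar>j i\<bar> \<le> B / h"
        using assms(2) by (simp add: abs_mult field_simps)
      then have "\<bar>j i\<bar> \<le> \<lceil>B / h\<rceil>"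
        by linarith
      then show ?thesis unfolding J_def by auto
    qed
    moreover have "x = (\<chi> i. h * of_int (j i))"
      by (simp add: vec_eq_iff j)
    ultimately show "x \<in> (\<lambda>j. \<chi> i. h * of_int (j i)) ` (UNIV \<rightarrow>\<^sub>E J)"
      by auto
  qed
  moreover have "finite (UNIV \<rightarrow>\<^sub>E J :: ('n \<Rightarrow> int) set)"
    by (rule finite_PiE) (auto simp: J_def)
  ultimately show ?thesis by (blast intro: finite_subset)
qed

lemma finite_mesh:
  assumes "bounded \<Omega>" "0 < \<tau>" "0 < h"
  shows "finite (mesh T \<Omega> \<tau> h)"
  unfolding mesh_def using finite_time_mesh finite_space_mesh assms by blast

lemma norm_le_linf:
  assumes "finite (mesh T \<Omega> \<tau> h)" "z \<in> mesh T \<Omega> \<tau> h" "linf T \<Omega> \<tau> h f \<le> B"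
  shows "norm (f z) \<le> B"
proof -
  have "norm (f z) \<le> linf T \<Omega> \<tau> h f"
    unfolding linf_def using assms(1,2) by (intro Max_ge) auto
  with assms(3) show ?thesis by linarith
qed

lemma linf_le:
  assumes "finite (mesh T \<Omega> \<tau> h)" "0 \<le> B" "\<And>z. z \<in> mesh T \<Omega> \<tau> h \<Longrightarrow> norm (f z) \<le> B"
  shows "linf T \<Omega> \<tau> h f \<le> B"
  unfolding linf_def using assms by (subst Max_le_iff) auto

text \<open>
  The mesh contains the initial time and possibly the final one, so the points do not
  all lie in the open domain.
\<close>

lemma mesh_subset_closure:
  assumes "0 < T" "0 < \<tau>"
  shows "mesh T \<Omega> \<tau> h \<subseteq> closure ({0<..<T} \<times> \<Omega>)"
proof -
  have "real k * \<tau> \<le> T" if "int k \<le> \<lfloor>T / \<tau>\<rfloor>" for k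
  proof -
    have "real k \<le> T / \<tau>" using that by (simp add: le_floor_iff)
    then show ?thesis using assms by (simp add: field_simps)
  qed
  then have "time_mesh T \<tau> \<subseteq> {0..T}"
    using assms by (auto simp: time_mesh_def)
  moreover have "space_mesh \<Omega> h \<subseteq> closure \<Omega>"
    using closure_subset by (auto simp: space_mesh_def)
  ultimately show ?thesis
    using assms by (auto simp: mesh_def closure_Times)
qed

lemma norm_matrix_vector_mult_le:
  fixes A :: "real ^ 'b::finite ^ 'a::finite"
  shows "norm (A *v x) \<le> op_norm A * norm x"
  unfolding op_norm_def by (rule onorm) (rule matrix_vector_mul_bounded_linear)

lemma sum_UNIV_Plus:
  fixes f :: "'a::finite + 'b::finite \<Rightarrow> 'c::comm_monoid_add"
  shows "sum f UNIV = (\<Sum>i\<in>UNIV. f (Inl i)) + (\<Sum>i\<in>UNIV. f (Inr i))"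
  by (subst UNIV_Plus_UNIV[symmetric], subst sum.Plus) auto

lemma norm_stack_squared: "(norm (stack a b))\<^sup>2 = (norm a)\<^sup>2 + (norm b)\<^sup>2"
  by (simp add: norm_vec_def L2_set_def sum_nonneg sum_UNIV_Plus stack_def)

lemma norm_stack_le: "norm (stack a b) \<le> norm a + norm b"
  by (rule power2_le_imp_le) (simp_all add: norm_stack_squared power2_sum)

lemma stack_upper_lower: "stack (upper y) (lower y) = y"
  by (simp add: vec_eq_iff stack_def upper_def lower_def split: sum.split)

lemma stack_diff: "stack a b - stack a' b' = stack (a - a') (b - b')"
  by (simp add: vec_eq_iff stack_def split: sum.split)

lemma norm_upper_le: "norm (upper y) \<le> norm y"
  by (rule power2_le_imp_le)
    (simp_all add: norm_stack_squared[of "upper y" "lower y", unfolded stack_upper_lower])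

lemma norm_lower_le: "norm (lower y) \<le> norm y"
  by (rule power2_le_imp_le)
    (simp_all add: norm_stack_squared[of "upper y" "lower y", unfolded stack_upper_lower])

lemma block_matrix_vector_mult:
  "A *v y = left_block A *v upper y + right_block A *v lower y"
  by (simp add: vec_eq_iff matrix_vector_mult_def left_block_def right_block_def upper_def
      lower_def sum_UNIV_Plus)

section \<open>Bounds along the jets of a smooth function\<close>

lemma has_partials_mono:
  assumes "has_partials k Q u w" "j \<le> k"
  shows "has_partials j Q u w"
  using assms unfolding has_partials_def by auto

text \<open>
  \<^const>\<open>partial\<close> makes a separate choice of derivatives for each multi-index, about which something is
  known only if a candidate exists. A family of derivatives up to the full order of smoothness is a
  candidate for every lower order.
\<close>

lemma continuous_on_partial:
  assumes "u \<in> C_closure k Q" "msize \<alpha> \<le> k"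
  shows "continuous_on (closure Q) (partial Q u \<alpha>)"
proof -
  obtain w where "has_partials k Q u w"
    using assms(1) by (auto simp: C_closure_def)
  then have "has_partials (msize \<alpha>) Q u w"
    using assms(2) by (rule has_partials_mono)
  then have "has_partials (msize \<alpha>) Q u (SOME w. has_partials (msize \<alpha>) Q u w)"
    by (rule someI[where P = "has_partials (msize \<alpha>) Q u"])
  then show ?thesis
    unfolding partial_def has_partials_def by blast
qed

lemma continuous_on_jet_coordinate:
  assumes "u \<in> C_closure k Q" "v \<in> jvars k"
  shows "continuous_on (closure Q) (\<lambda>z. jet_of Q u z v)"
proof (cases v)
  case (Indep c)
  then show ?thesis
    by (cases c) (auto simp: jet_of_def intro!: continuous_intros)
next
  case (Dep j \<alpha>)
  with assms(2) have "msize \<alpha> \<le> k"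
    by (auto simp: jvars_def)
  then show ?thesis
    using Dep continuous_on_partial[OF assms(1)]
    by (auto simp: jet_of_def intro!: continuous_intros)
qed

lemma base_jet_of: "base (jet_of Q u z) = z"
  by (simp add: base_def jet_of_def prod_eq_iff vec_eq_iff)

lemma finite_jvars: "finite (jvars k :: ('m::finite, 'n::finite) jvar set)"
proof -
  have "\<alpha> c \<le> msize \<alpha>" for \<alpha> :: "'n option \<Rightarrow> nat" and c
    unfolding msize_def by (rule member_le_sum) auto
  then have "{\<alpha> :: 'n option \<Rightarrow> nat. msize \<alpha> \<le> k} \<subseteq> UNIV \<rightarrow>\<^sub>E {..k}"
    by (auto intro: order_trans)
  moreover have "finite (UNIV \<rightarrow>\<^sub>E {..k} :: ('n option \<Rightarrow> nat) set)"
    by (rule finite_PiE) auto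
  ultimately have "finite {\<alpha> :: 'n option \<Rightarrow> nat. msize \<alpha> \<le> k}"
    by (rule finite_subset)
  then have "finite ((\<lambda>(j, \<alpha>). Dep j \<alpha>) ` ((UNIV :: 'm set) \<times> {\<alpha> :: 'n option \<Rightarrow> nat. msize \<alpha> \<le> k}))"
    by simp
  moreover have "(\<lambda>(j, \<alpha>). Dep j \<alpha>) ` ((UNIV :: 'm set) \<times> {\<alpha> :: 'n option \<Rightarrow> nat. msize \<alpha> \<le> k})
      = {Dep j \<alpha> |j \<alpha>. msize \<alpha> \<le> k}"
    by auto
  ultimately show ?thesis
    by (simp add: jvars_def)
qed

text \<open>
  Setting the coordinates of order above \<open>k\<close> to zero makes the jet of \<open>u\<close> a continuous function of the
  point for the product topology, so its image over the compact domain is compact. It does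
  not move the base point, and a function of order at most \<open>k\<close> does not notice it.
\<close>

lemma bounded_along_jets:
  fixes f :: "('m::finite, 'n::finite) jet \<Rightarrow> 'b::metric_space"
  assumes "bounded Q" "u \<in> C_closure k Q" "D = {z. base z \<in> closure Q}"
    and "continuous_on D f" "order_le D k f"
  shows "bounded ((\<lambda>z. f (jet_of Q u z)) ` closure Q)"
proof -
  define trunc where "trunc z = (\<lambda>v. if v \<in> jvars k then jet_of Q u z v else 0)" for z
  have cont: "continuous_on (closure Q) trunc"
  proof (rule continuous_on_coordinatewise_then_product)
    fix v show "continuous_on (closure Q) (\<lambda>z. trunc z v)"
      using continuous_on_jet_coordinate[OF assms(2)] by (cases "v \<in> jvars k") (auto simp: trunc_def)
  qed
  have base: "base (trunc z) = z" for z
    using base_jet_of[of Q u z] by (simp add: base_def trunc_def jvars_def)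
  have "f (trunc z) = f (jet_of Q u z)" if "z \<in> closure Q" for z
  proof -
    have "trunc z \<in> D" "jet_of Q u z \<in> D"
      using that by (simp_all add: assms(3) base base_jet_of)
    moreover have "\<forall>v\<in>jvars k. trunc z v = jet_of Q u z v"
      by (simp add: trunc_def)
    ultimately show ?thesis
      using assms(5) unfolding order_le_def by blast
  qed
  then have eq: "(\<lambda>z. f (jet_of Q u z)) ` closure Q = (f \<circ> trunc) ` closure Q"
    by auto
  have "trunc ` closure Q \<subseteq> D"
    by (auto simp: assms(3) base)
  then have "continuous_on (closure Q) (f \<circ> trunc)"
    using cont assms(4) by (blast intro: continuous_on_compose continuous_on_subset)
  moreover have "compact (closure Q)"
    using assms(1) by simp
  ultimately show ?thesis
    unfolding eq by (intro compact_imp_bounded compact_continuous_image)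
qed

text \<open>
  For real series unconditional convergence is absolute. Hence the sum of the absolute values
  of the terms at the corner \<open>z0 + \<rho>/2\<close> dominates the series on the whole cube.
\<close>

lemma analytic_order_locally_bounded:
  assumes "analytic_order D k f" "z0 \<in> D"
  obtains \<delta> M where "0 < \<delta>" "\<And>z. (\<forall>v\<in>jvars k. \<bar>z v - z0 v\<bar> < \<delta>) \<Longrightarrow> \<bar>f z\<bar> \<le> M"
proof -
  define B where "B = {\<beta> :: ('a, 'b) jvar \<Rightarrow> nat. \<forall>v. v \<notin> jvars k \<longrightarrow> \<beta> v = 0}"
  obtain \<rho> a where \<rho>: "0 < \<rho>" and series: "\<And>z. \<forall>v\<in>jvars k. \<bar>z v - z0 v\<bar> < \<rho> \<Longrightarrow>
      ((\<lambda>\<beta>. a \<beta> * (\<Prod>v\<in>jvars k. (z v - z0 v) ^ \<beta> v)) has_sum f z) B"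
    using assms unfolding analytic_order_def B_def by meson
  define corner where "corner \<beta> = a \<beta> * (\<Prod>v\<in>jvars k. (\<rho> / 2) ^ \<beta> v)" for \<beta>
  have "(corner has_sum f (\<lambda>v. z0 v + \<rho> / 2)) B"
    using series[of "\<lambda>v. z0 v + \<rho> / 2"] \<rho> by (simp add: corner_def[abs_def])
  then have corner: "(\<lambda>\<beta>. norm (corner \<beta>)) summable_on B"
    using summable_on_iff_abs_summable_on_real has_sum_imp_summable by blast
  show ?thesis
  proof
    show "0 < \<rho> / 2" using \<rho> by simp
    fix z assume z: "\<forall>v\<in>jvars k. \<bar>z v - z0 v\<bar> < \<rho> / 2"
    define t where "t \<beta> = a \<beta> * (\<Prod>v\<in>jvars k. (z v - z0 v) ^ \<beta> v)" for \<beta>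
    have "\<forall>v\<in>jvars k. \<bar>z v - z0 v\<bar> < \<rho>"
      using z \<rho> by fastforce
    then have sum: "(t has_sum f z) B"
      unfolding t_def[abs_def] by (rule series)
    have le: "norm (t \<beta>) \<le> norm (corner \<beta>)" for \<beta>
    proof -
      have "(\<Prod>v\<in>jvars k. \<bar>z v - z0 v\<bar> ^ \<beta> v) \<le> (\<Prod>v\<in>jvars k. (\<rho> / 2) ^ \<beta> v)"
        using z by (intro prod_mono) (auto intro!: power_mono intro: less_imp_le)
      then show ?thesis
        using \<rho> by (simp add: t_def corner_def abs_mult abs_prod power_abs mult_left_mono)
    qed
    have "(\<lambda>\<beta>. norm (t \<beta>)) summable_on B"
      using sum summable_on_iff_abs_summable_on_real has_sum_imp_summable by blast
    then have "norm (infsum t B) \<le> (\<Sum>\<^sub>\<infinity>\<beta>\<in>B. norm (t \<beta>))"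
      by (rule norm_infsum_bound)
    also have "\<dots> \<le> (\<Sum>\<^sub>\<infinity>\<beta>\<in>B. norm (corner \<beta>))"
      using \<open>(\<lambda>\<beta>. norm (t \<beta>)) summable_on B\<close> corner le by (intro infsum_mono)
    finally show "\<bar>f z\<bar> \<le> (\<Sum>\<^sub>\<infinity>\<beta>\<in>B. norm (corner \<beta>))"
      using infsumI[OF sum] by simp
  qed
qed

text \<open>
  Only finitely many coordinates have order at most \<open>k\<close>, so a local bound on a cube in these
  coordinates pulls back to a neighbourhood of the point in space-time; finitely many of these
  neighbourhoods cover the compact domain.
\<close>

lemma analytic_order_bounded_along_jets:
  fixes f :: "('m::finite, 'n::finite) jet \<Rightarrow> real"
  assumes "bounded Q" "u \<in> C_closure k Q" "D = {z. base z \<in> closure Q}" "analytic_order D k f"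
  shows "bounded ((\<lambda>z. f (jet_of Q u z)) ` closure Q)"
proof -
  let ?g = "\<lambda>z. f (jet_of Q u z)"
  have "\<exists>V. open V \<and> y \<in> V \<and> bounded (?g ` (V \<inter> closure Q))" if y: "y \<in> closure Q" for y
  proof -
    have "jet_of Q u y \<in> D"
      using y by (simp add: assms(3) base_jet_of)
    then obtain \<delta> M where "0 < \<delta>" and
      M: "\<And>z. (\<forall>v\<in>jvars k. \<bar>z v - jet_of Q u y v\<bar> < \<delta>) \<Longrightarrow> \<bar>f z\<bar> \<le> M"
      using analytic_order_locally_bounded[OF assms(4)] by metis
    have "\<forall>\<^sub>F x in at y within closure Q. \<bar>jet_of Q u x v - jet_of Q u y v\<bar> < \<delta>"
      if "v \<in> jvars k" for v
      using continuous_on_jet_coordinate[OF assms(2) that] y \<open>0 < \<delta>\<close>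
      by (auto simp: continuous_on tendsto_iff dist_real_def)
    then have "\<forall>\<^sub>F x in at y within closure Q. \<forall>v\<in>jvars k. \<bar>jet_of Q u x v - jet_of Q u y v\<bar> < \<delta>"
      by (simp add: eventually_ball_finite_distrib[OF finite_jvars])
    then obtain V where V: "open V" "y \<in> V" "\<And>x. x \<in> V \<Longrightarrow> x \<noteq> y \<Longrightarrow> x \<in> closure Q \<Longrightarrow>
        \<forall>v\<in>jvars k. \<bar>jet_of Q u x v - jet_of Q u y v\<bar> < \<delta>"
      unfolding eventually_at_topological by metis
    have "\<bar>?g x\<bar> \<le> M" if "x \<in> V" "x \<in> closure Q" for x
      using V(3)[of x] that \<open>0 < \<delta>\<close> by (cases "x = y") (auto intro: M)
    then have "bounded (?g ` (V \<inter> closure Q))"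
      unfolding bounded_iff by (intro exI[of _ M]) auto
    with V show ?thesis by blast
  qed
  then obtain V where V: "\<And>y. y \<in> closure Q \<Longrightarrow> open (V y)" "\<And>y. y \<in> closure Q \<Longrightarrow> y \<in> V y"
      "\<And>y. y \<in> closure Q \<Longrightarrow> bounded (?g ` (V y \<inter> closure Q))"
    by metis
  have "compact (closure Q)"
    using assms(1) by simp
  moreover have "closure Q \<subseteq> (\<Union>y\<in>closure Q. V y)"
    using V(2) by blast
  ultimately obtain Y where Y: "Y \<subseteq> closure Q" "finite Y" "closure Q \<subseteq> (\<Union>y\<in>Y. V y)"
    using compactE_image[of "closure Q" "closure Q" V] V(1) by blast
  have "bounded (\<Union>y\<in>Y. ?g ` (V y \<inter> closure Q))"
    using Y V(3) by (intro bounded_UN) auto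
  then show ?thesis
    by (rule bounded_subset) (use Y(3) in blast)
qed

section \<open>The pointwise error estimate\<close>

text \<open>
  Multiplying by \<open>Lh\<close> and writing \<open>Lh = L - (L - Lh)\<close> brings in \<open>L *v f\<close>, which the conservation law
  eliminates. The products \<open>S *v g\<close> and \<open>Sh *v gh\<close> are compared through \<open>S\<close> and \<open>g\<close>, because
  only these are bounded independently of the mesh; the price is the product of two differences.
\<close>

lemma block_error_identity:
  fixes L Lh :: "real ^ 's::finite ^ 's" and S Sh :: "real ^ 'g::finite ^ 's"
  assumes "L *v f + S *v g = a + b" "invertible Lh"
  shows "f - matrix_inv Lh *v (ah + bh - Sh *v gh) =
    matrix_inv Lh *v ((a - ah) + (b - bh) - (L - Lh) *v f - (S - Sh) *v g
      - S *v (g - gh) + (S - Sh) *v (g - gh))"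
proof -
  have "matrix_inv Lh ** Lh = mat 1"
    using assms(2) unfolding invertible_def matrix_inv_def by (rule someI2_ex) simp
  then have "f = matrix_inv Lh *v (Lh *v f)"
    by (simp add: matrix_vector_mul_assoc)
  moreover have "Lh *v f - (ah + bh - Sh *v gh) = (a - ah) + (b - bh) - (L - Lh) *v f
      - (S - Sh) *v g - S *v (g - gh) + (S - Sh) *v (g - gh)"
    using assms(1) by (simp add: algebra_simps matrix_vector_mult_diff_rdistrib)
  ultimately show ?thesis
    by (metis matrix_vector_mult_diff_distrib)
qed

text \<open>
  The product of the errors of \<open>S\<close> and \<open>g\<close> is quadratic in \<open>e\<close>; the bound \<open>e \<le> 2\<close> makes it linear.
\<close>

lemma block_error_estimate:
  fixes L Lh :: "real ^ 's::finite ^ 's" and S Sh :: "real ^ 'g::finite ^ 's"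
  assumes "L *v f + S *v g = a + b" "invertible Lh"
    and "op_norm (matrix_inv Lh) \<le> \<gamma>" "0 \<le> \<gamma>"
    and "norm f \<le> M" "norm g \<le> M" "op_norm S \<le> N" "0 \<le> N"
    and "op_norm (L - Lh) \<le> CL * e" "norm (a - ah) \<le> Ct * e" "norm (b - bh) \<le> Cx * e"
      "op_norm (S - Sh) \<le> CS * e" "norm (g - gh) \<le> CG * e"
    and "0 \<le> e" "e \<le> 2" "0 \<le> CL" "0 \<le> CS" "0 \<le> CG"
  shows "norm (f - matrix_inv Lh *v (ah + bh - Sh *v gh))
    \<le> \<gamma> * (Ct + Cx + CL * M + CS * M + N * CG + 2 * CS * CG) * e"
proof -
  have mv: "norm (A *v x) \<le> \<alpha> * \<beta>" if "op_norm A \<le> \<alpha>" "norm x \<le> \<beta>" "0 \<le> \<alpha>"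
    for A :: "real ^ 'c::finite ^ 'd::finite" and x \<alpha> \<beta>
    using norm_matrix_vector_mult_le[of A x] mult_mono[OF that(1,2,3)] by fastforce
  define R where "R = (a - ah) + (b - bh) - (L - Lh) *v f - (S - Sh) *v g
      - S *v (g - gh) + (S - Sh) *v (g - gh)"
  have "norm (x1 + x2 - x3 - x4 - x5 + x6) \<le> e1 + e2 + e3 + e4 + e5 + e6"
    if "norm x1 \<le> e1" "norm x2 \<le> e2" "norm x3 \<le> e3" "norm x4 \<le> e4" "norm x5 \<le> e5"
      "norm x6 \<le> e6" for x1 x2 x3 x4 x5 x6 :: "real ^ 's" and e1 e2 e3 e4 e5 e6
    by (intro norm_triangle_le norm_triangle_le_diff add_mono that)
  moreover have "norm ((L - Lh) *v f) \<le> CL * e * M" "norm ((S - Sh) *v g) \<le> CS * e * M"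
    "norm (S *v (g - gh)) \<le> N * (CG * e)"
    by (rule mv; use assms in simp)+
  moreover have "norm ((S - Sh) *v (g - gh)) \<le> 2 * CS * (CG * e)"
  proof -
    have "CS * e \<le> 2 * CS"
      using assms(15,17) by (simp add: mult.commute mult_left_mono)
    then have "op_norm (S - Sh) \<le> 2 * CS"
      using assms(12) by linarith
    then show ?thesis
      by (rule mv) (use assms in simp_all)
  qed
  ultimately have "norm R \<le> Ct * e + Cx * e + CL * e * M + CS * e * M + N * (CG * e)
      + 2 * CS * (CG * e)"
    unfolding R_def using assms(10,11) by blast
  also have "\<dots> = (Ct + Cx + CL * M + CS * M + N * CG + 2 * CS * CG) * e"
    by (simp add: algebra_simps)
  finally have "norm (matrix_inv Lh *v R)
      \<le> \<gamma> * ((Ct + Cx + CL * M + CS * M + N * CG + 2 * CS * CG) * e)"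
    using assms(3,4) by (intro mv)
  then show ?thesis
    unfolding block_error_identity[OF assms(1,2)] R_def by (simp add: mult.assoc)
qed

section \<open>Accuracy of the conservative discretization\<close>

theorem theorem6:
  fixes T :: real and \<Omega> :: "(real ^ 'n::finite) set"
    and Q :: "(real \<times> (real ^ 'n)) set" and D :: "('s::finite + 'g::finite, 'n) jet set"
    and p q r d :: nat
    and F :: "('s + 'g, 'n) jet \<Rightarrow> real ^ ('s + 'g)"
    and \<Lambda> :: "('s + 'g, 'n) jet \<Rightarrow> real ^ ('s + 'g) ^ 's"
    and \<psi> :: "('s + 'g, 'n) jet \<Rightarrow> real ^ 's"
    and \<Phi> :: "('s + 'g, 'n) jet \<Rightarrow> real ^ 'n ^ 's"
    and u :: "real \<times> (real ^ 'n) \<Rightarrow> real ^ ('s + 'g)"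
    and Lh :: "('s + 'g, 'n, real ^ 's ^ 's) fd_op"
    and Dth Dxh :: "('s + 'g, 'n, real ^ 's) fd_op"
    and Sh :: "('s + 'g, 'n, real ^ 'g ^ 's) fd_op"
    and Gh :: "('s + 'g, 'n, real ^ 'g) fd_op"
    and U :: "real \<Rightarrow> real \<Rightarrow> (real \<times> (real ^ 'n) \<Rightarrow> real ^ ('s + 'g)) set"
    and CL Ct Cx CS CG \<gamma> \<tau>0 h0 :: real
  assumes T: "0 < T"
    and Om: "open \<Omega>" "connected \<Omega>" "\<Omega> \<noteq> {}" "bounded \<Omega>"
    and Q: "Q = {0<..<T} \<times> \<Omega>"
    and D: "D = {z. base z \<in> closure Q}"
    and F: "1 \<le> d" "continuous_on D F" "order_le D d F"
    and cl: "conservation_law_multipliers D r d F \<Lambda> \<psi> \<Phi>"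
    and u: "u \<in> C_closure (max p q + max r d) Q"
    and fd: "fd_discretization T \<Omega> Lh" "fd_discretization T \<Omega> Dth" "fd_discretization T \<Omega> Dxh"
      "fd_discretization T \<Omega> Sh" "fd_discretization T \<Omega> Gh"
    and small: "0 < \<tau>0" "0 < h0"
    and acc_L: "\<And>\<tau> h. 0 < \<tau> \<Longrightarrow> \<tau> < \<tau>0 \<Longrightarrow> 0 < h \<Longrightarrow> h < h0 \<Longrightarrow>
      linf T \<Omega> \<tau> h (\<lambda>z. op_norm (left_block (\<Lambda> (jet_of Q u z)) - Lh \<tau> h u z)) \<le> CL * (h ^ p + \<tau> ^ q)"
    and acc_t: "\<And>\<tau> h. 0 < \<tau> \<Longrightarrow> \<tau> < \<tau>0 \<Longrightarrow> 0 < h \<Longrightarrow> h < h0 \<Longrightarrow>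
      linf T \<Omega> \<tau> h (\<lambda>z. Dt (max r d - 1) \<psi> (jet_of Q u z) - Dth \<tau> h u z) \<le> Ct * (h ^ p + \<tau> ^ q)"
    and acc_x: "\<And>\<tau> h. 0 < \<tau> \<Longrightarrow> \<tau> < \<tau>0 \<Longrightarrow> 0 < h \<Longrightarrow> h < h0 \<Longrightarrow>
      linf T \<Omega> \<tau> h (\<lambda>z. Dx (max r d - 1) \<Phi> (jet_of Q u z) - Dxh \<tau> h u z) \<le> Cx * (h ^ p + \<tau> ^ q)"
    and acc_S: "\<And>\<tau> h. 0 < \<tau> \<Longrightarrow> \<tau> < \<tau>0 \<Longrightarrow> 0 < h \<Longrightarrow> h < h0 \<Longrightarrow>
      linf T \<Omega> \<tau> h (\<lambda>z. op_norm (right_block (\<Lambda> (jet_of Q u z)) - Sh \<tau> h u z)) \<le> CS * (h ^ p + \<tau> ^ q)"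
    and acc_G: "\<And>\<tau> h. 0 < \<tau> \<Longrightarrow> \<tau> < \<tau>0 \<Longrightarrow> 0 < h \<Longrightarrow> h < h0 \<Longrightarrow>
      linf T \<Omega> \<tau> h (\<lambda>z. lower (F (jet_of Q u z)) - Gh \<tau> h u z) \<le> CG * (h ^ p + \<tau> ^ q)"
    \<comment> \<open>\<open>U \<tau> h\<close>: the discrete functions on which the scheme is defined\<close>
    and U: "\<And>\<tau> h. 0 < \<tau> \<Longrightarrow> \<tau> < \<tau>0 \<Longrightarrow> 0 < h \<Longrightarrow> h < h0 \<Longrightarrow> u \<in> U \<tau> h"
    and inv: "\<And>\<tau> h uh z. 0 < \<tau> \<Longrightarrow> \<tau> < \<tau>0 \<Longrightarrow> 0 < h \<Longrightarrow> h < h0 \<Longrightarrow> uh \<in> U \<tau> h \<Longrightarrow>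
      z \<in> mesh T \<Omega> \<tau> h \<Longrightarrow> invertible (Lh \<tau> h uh z)"
    and inv_bound: "\<And>\<tau> h uh. 0 < \<tau> \<Longrightarrow> \<tau> < \<tau>0 \<Longrightarrow> 0 < h \<Longrightarrow> h < h0 \<Longrightarrow> uh \<in> U \<tau> h \<Longrightarrow>
      linf T \<Omega> \<tau> h (\<lambda>z. op_norm (matrix_inv (Lh \<tau> h uh z))) \<le> \<gamma>"
  shows "(\<exists>C>0. \<exists>\<tau>1>0. \<exists>h1>0. \<forall>\<tau> h. 0 < \<tau> \<and> \<tau> < \<tau>1 \<and> 0 < h \<and> h < h1 \<longrightarrow>
      linf T \<Omega> \<tau> h (\<lambda>z. upper (F (jet_of Q u z)) - Ftilde_disc Lh Dth Dxh Sh Gh \<tau> h u z)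
        \<le> C * (h ^ p + \<tau> ^ q)) \<and>
    (\<exists>C>0. \<exists>\<tau>1>0. \<exists>h1>0. \<forall>\<tau> h. 0 < \<tau> \<and> \<tau> < \<tau>1 \<and> 0 < h \<and> h < h1 \<longrightarrow>
      linf T \<Omega> \<tau> h (\<lambda>z. F (jet_of Q u z) - F_disc Lh Dth Dxh Sh Gh \<tau> h u z)
        \<le> C * (h ^ p + \<tau> ^ q))"
proof -
  have boundedQ: "bounded Q"
    using Om(4) Q by (auto intro: bounded_Times)
  have jetD: "jet_of Q u z \<in> D" if "z \<in> closure Q" for z
    using that by (simp add: D base_jet_of)
  have smooth: "u \<in> C_closure k Q" if "k \<le> max p q + max r d" for k
    using u has_partials_mono[OF _ that] by (auto simp: C_closure_def)
  have "bounded ((\<lambda>z. F (jet_of Q u z)) ` closure Q)"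
    using boundedQ smooth[of d] D F(2,3) by (intro bounded_along_jets) auto
  then obtain M where M: "\<And>z. z \<in> closure Q \<Longrightarrow> norm (F (jet_of Q u z)) \<le> M"
    by (auto simp: bounded_iff)
  have "\<exists>b. \<forall>z\<in>closure Q. \<bar>\<Lambda> (jet_of Q u z) $ j $ k\<bar> \<le> b" for j k
  proof -
    have "analytic_order D r (\<lambda>z. \<Lambda> z $ j $ k)"
      using cl by (simp add: conservation_law_multipliers_def)
    then have "bounded ((\<lambda>z. \<Lambda> (jet_of Q u z) $ j $ k) ` closure Q)"
      using boundedQ smooth[of r] D by (intro analytic_order_bounded_along_jets) auto
    then show ?thesis by (auto simp: bounded_iff)
  qed
  then obtain b where b: "\<And>j k z. z \<in> closure Q \<Longrightarrow> \<bar>\<Lambda> (jet_of Q u z) $ j $ k\<bar> \<le> b j k"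
    by metis
  define b' where "b' = (\<Sum>j\<in>UNIV. \<Sum>k\<in>UNIV. \<bar>b j k\<bar>)"
  have b': "\<bar>\<Lambda> (jet_of Q u z) $ j $ k\<bar> \<le> b'" if "z \<in> closure Q" for j k z
  proof -
    have "\<bar>b j k\<bar> \<le> (\<Sum>k\<in>UNIV. \<bar>b j k\<bar>)"
      by (rule member_le_sum) auto
    also have "\<dots> \<le> b'"
      unfolding b'_def by (rule member_le_sum[of j UNIV "\<lambda>j. \<Sum>k\<in>UNIV. \<bar>b j k\<bar>"]) (auto intro: sum_nonneg)
    finally show ?thesis using b[OF that, of j k] by linarith
  qed
  define N where "N = real CARD('s) * real CARD('g) * b'"
  have N: "op_norm (right_block (\<Lambda> (jet_of Q u z))) \<le> N" if "z \<in> closure Q" for z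
    unfolding op_norm_def N_def
    by (rule onorm_le_matrix_component) (simp add: right_block_def b'[OF that])
  have "0 \<le> b'"
    by (simp add: b'_def sum_nonneg)
  then have N0: "0 \<le> N"
    by (simp add: N_def)
  define K where "K = \<bar>\<gamma>\<bar> * (\<bar>Ct\<bar> + \<bar>Cx\<bar> + \<bar>CL\<bar> * \<bar>M\<bar> + \<bar>CS\<bar> * \<bar>M\<bar> + N * \<bar>CG\<bar> + 2 * \<bar>CS\<bar> * \<bar>CG\<bar>)"
  have K0: "0 \<le> K"
    unfolding K_def using N0 by (intro mult_nonneg_nonneg add_nonneg_nonneg) auto
  \<comment> \<open>Steps of size at most \<open>1\<close> give \<open>h ^ p + \<tau> ^ q \<le> 2\<close>, also when \<open>p\<close> or \<open>q\<close> is \<open>0\<close>.\<close>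
  define \<tau>1 where "\<tau>1 = min \<tau>0 1"
  define h1 where "h1 = min h0 1"
  have pos: "0 < \<tau>1" "0 < h1"
    using small by (auto simp: \<tau>1_def h1_def)
  have est: "norm (upper (F (jet_of Q u z)) - Ftilde_disc Lh Dth Dxh Sh Gh \<tau> h u z) \<le> K * (h ^ p + \<tau> ^ q) \<and>
      norm (lower (F (jet_of Q u z)) - Gh \<tau> h u z) \<le> \<bar>CG\<bar> * (h ^ p + \<tau> ^ q)"
    if h: "0 < \<tau>" "\<tau> < \<tau>1" "0 < h" "h < h1" and z: "z \<in> mesh T \<Omega> \<tau> h" for \<tau> h z
  proof -
    have h0: "0 < \<tau>" "\<tau> < \<tau>0" "0 < h" "h < h0" and le1: "\<tau> \<le> 1" "h \<le> 1"
      using h by (auto simp: \<tau>1_def h1_def)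
    define e where "e = h ^ p + \<tau> ^ q"
    have e: "0 \<le> e" "e \<le> 2"
      using h0 le1 power_le_one[of h p] power_le_one[of \<tau> q] by (auto simp: e_def)
    have abs_e: "C * e \<le> \<bar>C\<bar> * e" for C
      using e(1) by (simp add: mult_right_mono)
    have fin: "finite (mesh T \<Omega> \<tau> h)"
      using Om(4) h0 by (simp add: finite_mesh)
    have zQ: "z \<in> closure Q"
      using mesh_subset_closure[OF T h0(1)] z Q by blast
    note at_z = norm_le_linf[OF fin z]
    let ?J = "jet_of Q u z"
    have "\<Lambda> ?J *v F ?J = Dt (max r d - 1) \<psi> ?J + Dx (max r d - 1) \<Phi> ?J"
      using cl jetD[OF zQ] by (auto simp: conservation_law_multipliers_def)
    then have law: "left_block (\<Lambda> ?J) *v upper (F ?J) + right_block (\<Lambda> ?J) *v lower (F ?J)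
        = Dt (max r d - 1) \<psi> ?J + Dx (max r d - 1) \<Phi> ?J"
      by (simp add: block_matrix_vector_mult)
    have L: "op_norm (left_block (\<Lambda> ?J) - Lh \<tau> h u z) \<le> \<bar>CL\<bar> * e"
      using at_z[OF acc_L[OF h0]] abs_e[of CL] by (simp add: e_def)
    have t: "norm (Dt (max r d - 1) \<psi> ?J - Dth \<tau> h u z) \<le> \<bar>Ct\<bar> * e"
      using at_z[OF acc_t[OF h0]] abs_e[of Ct] by (simp add: e_def)
    have x: "norm (Dx (max r d - 1) \<Phi> ?J - Dxh \<tau> h u z) \<le> \<bar>Cx\<bar> * e"
      using at_z[OF acc_x[OF h0]] abs_e[of Cx] by (simp add: e_def)
    have S: "op_norm (right_block (\<Lambda> ?J) - Sh \<tau> h u z) \<le> \<bar>CS\<bar> * e"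
      using at_z[OF acc_S[OF h0]] abs_e[of CS] by (simp add: e_def)
    have G: "norm (lower (F ?J) - Gh \<tau> h u z) \<le> \<bar>CG\<bar> * e"
      using at_z[OF acc_G[OF h0]] abs_e[of CG] by (simp add: e_def)
    have g: "op_norm (matrix_inv (Lh \<tau> h u z)) \<le> \<bar>\<gamma>\<bar>"
      using at_z[OF inv_bound[OF h0 U[OF h0]]] by simp
    have "norm (upper (F ?J)) \<le> \<bar>M\<bar>" "norm (lower (F ?J)) \<le> \<bar>M\<bar>"
      using M[OF zQ] norm_upper_le[of "F ?J"] norm_lower_le[of "F ?J"] by linarith+
    from block_error_estimate[OF law inv[OF h0 U[OF h0] z] g _ this N[OF zQ] N0 L t x S G e]
    have "norm (upper (F ?J) - Ftilde_disc Lh Dth Dxh Sh Gh \<tau> h u z) \<le> K * e"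
      by (simp add: Ftilde_disc_def K_def)
    with G show ?thesis by (simp add: e_def)
  qed
  have sum_nn: "0 \<le> C * (h ^ p + \<tau> ^ q)" if "0 < \<tau>" "0 < h" "0 \<le> C" for \<tau> h C :: real
    using that by simp
  \<comment> \<open>The added \<open>1\<close> makes the constant positive when \<open>K = 0\<close>.\<close>
  have tilde: "linf T \<Omega> \<tau> h (\<lambda>z. upper (F (jet_of Q u z)) - Ftilde_disc Lh Dth Dxh Sh Gh \<tau> h u z)
      \<le> (K + 1) * (h ^ p + \<tau> ^ q)"
    if h: "0 < \<tau>" "\<tau> < \<tau>1" "0 < h" "h < h1" for \<tau> h
  proof (rule linf_le)
    show "finite (mesh T \<Omega> \<tau> h)"
      using Om(4) h by (simp add: finite_mesh)
    show "0 \<le> (K + 1) * (h ^ p + \<tau> ^ q)"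
      using h K0 by simp
    fix z assume "z \<in> mesh T \<Omega> \<tau> h"
    with est[OF h, of z] sum_nn[OF h(1,3), of 1]
    show "norm (upper (F (jet_of Q u z)) - Ftilde_disc Lh Dth Dxh Sh Gh \<tau> h u z)
        \<le> (K + 1) * (h ^ p + \<tau> ^ q)"
      by (simp add: distrib_right)
  qed
  have full: "linf T \<Omega> \<tau> h (\<lambda>z. F (jet_of Q u z) - F_disc Lh Dth Dxh Sh Gh \<tau> h u z)
      \<le> (K + \<bar>CG\<bar> + 1) * (h ^ p + \<tau> ^ q)"
    if h: "0 < \<tau>" "\<tau> < \<tau>1" "0 < h" "h < h1" for \<tau> h
  proof (rule linf_le)
    show "finite (mesh T \<Omega> \<tau> h)"
      using Om(4) h by (simp add: finite_mesh)
    show "0 \<le> (K + \<bar>CG\<bar> + 1) * (h ^ p + \<tau> ^ q)"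
      using h K0 by simp
    fix z assume z: "z \<in> mesh T \<Omega> \<tau> h"
    have "F (jet_of Q u z) - F_disc Lh Dth Dxh Sh Gh \<tau> h u z =
        stack (upper (F (jet_of Q u z)) - Ftilde_disc Lh Dth Dxh Sh Gh \<tau> h u z)
          (lower (F (jet_of Q u z)) - Gh \<tau> h u z)"
      unfolding F_disc_def stack_diff[symmetric] stack_upper_lower by simp
    then have "norm (F (jet_of Q u z) - F_disc Lh Dth Dxh Sh Gh \<tau> h u z) \<le>
        norm (upper (F (jet_of Q u z)) - Ftilde_disc Lh Dth Dxh Sh Gh \<tau> h u z) +
        norm (lower (F (jet_of Q u z)) - Gh \<tau> h u z)"
      by (simp add: norm_stack_le)
    with est[OF h z] sum_nn[OF h(1,3), of 1]
    show "norm (F (jet_of Q u z) - F_disc Lh Dth Dxh Sh Gh \<tau> h u z)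
        \<le> (K + \<bar>CG\<bar> + 1) * (h ^ p + \<tau> ^ q)"
      by (simp add: distrib_right)
  qed
  have "0 < K + 1" "0 < K + \<bar>CG\<bar> + 1"
    using K0 by auto
  with tilde full pos show ?thesis
    by blast
qed

end
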